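(* Let $p:[-1,1]\to[1,\infty)$ be continuous. Suppose that $\mathcal I(u^* )\le \mathcal I(u)$ holds for every piecewise linear function $u\in \mathring{W}{}^1_1(-1,1)$ with $u\ge 0$, where $\mathcal I(u)=\int_{-1}^{1}(1+|u'(x)|^2)^{p(x)/2}\,dx$ and $u^*$ is the symmetrization of $u$. Then $p$ is even and convex on $[-1,1]$. Moreover, the function $$K(s,x)=s\,(1+s^{-2})^{\frac{p(x)}{2}},\qquad s>0,\ x\in[-1,1],$$ is convex (jointly in $(s,x)$) on $(0,\infty)\times[-1,1]$.
   Context: $\mathring{W}{}^1_1(-1,1)$ is the Sobolev space of absolutely continuous functions on $[-1,1]$ with integrable derivative that vanish at $\pm1$. A piecewise linear function is a continuous function that is affine on each interval of some finite partition of $[-1,1]$. For a measurable set $E\subset[-1,1]$ put $E^*=\left[-\frac{|E|}{2},\frac{|E|}{2}\right]$, where $|E|$ is Lebesgue measure. For a nonnegative $u\in\mathring{W}{}^1_1(-1,1)$ put $\mathcal A_t=\{x\in[-1,1]: u(x)>t\}$; the symmetrization (symmetric rearrangement) of $u$ is $u^*(x)=\int_0^\infty \chi_{\mathcal A_t^*}(x)\,dt$, where $\chi$ denotes the characteristic function. *)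

theory Defs
  imports "HOL-Analysis.Analysis"
begin

text \<open>Functions on \<open>[-1,1]\<close> are represented by total functions \<open>real \<Rightarrow> real\<close>. Their values outside
  \<open>[-1,1]\<close> play no role; in particular \<^term>\<open>deriv u x\<close> depends on them at most for \<open>x = \<plusminus>1\<close>, a null set.\<close>

definition abs_continuous_on :: "real \<Rightarrow> real \<Rightarrow> (real \<Rightarrow> real) \<Rightarrow> bool" where
  "abs_continuous_on a b u \<longleftrightarrow>
     (\<forall>\<epsilon>>0. \<exists>\<delta>>0. \<forall>\<D>. \<D> division_of \<Union>\<D> \<and> \<Union>\<D> \<subseteq> {a..b} \<and> (\<Sum>J\<in>\<D>. Sup J - Inf J) < \<delta>
        \<longrightarrow> (\<Sum>J\<in>\<D>. \<bar>u (Sup J) - u (Inf J)\<bar>) < \<epsilon>)"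

definition W11_zero :: "(real \<Rightarrow> real) set" where
  "W11_zero = {u. abs_continuous_on (-1) 1 u \<and> set_integrable lebesgue {-1..1} (deriv u)
                 \<and> u (-1) = 0 \<and> u 1 = 0}"

definition piecewise_linear_on :: "real \<Rightarrow> real \<Rightarrow> (real \<Rightarrow> real) \<Rightarrow> bool" where
  "piecewise_linear_on a b u \<longleftrightarrow> continuous_on {a..b} u \<and>
     (\<exists>\<D>. \<D> division_of {a..b} \<and> (\<forall>J\<in>\<D>. \<exists>m c. \<forall>x\<in>J. u x = m * x + c))"

text \<open>The empty set is symmetrized to itself. Taking the formula \<open>[-|E|/2, |E|/2]\<close> literally would
  give \<open>{0}\<close>, and the layer-cake integral below would then diverge at \<open>x = 0\<close> for every \<open>u\<close>.\<close>

definition symm_set :: "real set \<Rightarrow> real set" where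
  "symm_set E = (if E = {} then {} else {- measure lebesgue E / 2 .. measure lebesgue E / 2})"

definition superlevel :: "(real \<Rightarrow> real) \<Rightarrow> real \<Rightarrow> real set" where
  "superlevel u t = {x \<in> {-1..1}. u x > t}"

definition symmetrization :: "(real \<Rightarrow> real) \<Rightarrow> real \<Rightarrow> real" where
  "symmetrization u x =
     set_lebesgue_integral lebesgue {0..} (\<lambda>t. indicat_real (symm_set (superlevel u t)) x)"

text \<open>The functional takes values in \<open>[0,\<infinity>]\<close>.\<close>

definition energy :: "(real \<Rightarrow> real) \<Rightarrow> (real \<Rightarrow> real) \<Rightarrow> ennreal" where
  "energy p u =
     (\<integral>\<^sup>+x\<in>{-1..1}. ennreal ((1 + \<bar>deriv u x\<bar>\<^sup>2) powr (p x / 2)) \<partial>lebesgue)"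

definition K :: "(real \<Rightarrow> real) \<Rightarrow> real \<Rightarrow> real \<Rightarrow> real" where
  "K p s x = s * (1 + s powi (-2)) powr (p x / 2)"

end

theory Submission
  imports Defs "HOL-Real_Asymp.Real_Asymp"
begin

text \<open>
  The hypothesis is tested on trapezoids: functions that rise from \<open>0\<close> at \<open>A\<close> to a small height \<open>h\<close>
  with slope \<open>1/r\<close>, stay there, and fall back to \<open>0\<close> at \<open>B\<close> with slope \<open>-1/s\<close>. The superlevel
  set at height \<open>t < h\<close> is the interval from \<open>A + r t\<close> to \<open>B - s t\<close>, whose half-length is
  \<open>(B - A)/2 - m t\<close> with \<open>m = (r + s)/2\<close>. So the symmetrization is again a trapezoid, supported on
  \<open>[-(B - A)/2, (B - A)/2]\<close>, with both inverse slopes equal to the mean \<open>m\<close>.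

  A sloped piece of inverse slope \<open>q\<close> has length \<open>q h\<close> and energy density \<open>(1 + q\<^sup>-\<^sup>2)\<close> to the power
  \<open>p(x)/2\<close>, hence energy \<open>h K(q, x\<^sub>0) + o(h)\<close> if it starts or ends at the fixed point \<open>x\<^sub>0\<close>; flat
  pieces have density \<open>1\<close>, and their total length \<open>2 - (r + s) h\<close> does not change under
  symmetrization. Both energies equal \<open>2\<close> at \<open>h = 0\<close>, so comparing their derivatives there gives

    \<open>K(m, -(B - A)/2) + K(m, (B - A)/2) \<le> K(r, A) + K(s, B)\<close>

  for all \<open>-1 \<le> A < B \<le> 1\<close> and \<open>r, s > 0\<close> (\<open>K_inequality_of_symmetrization\<close>).

  All claims follow from this inequality. For large \<open>s\<close> one has
  \<open>K(s, x) = s + p(x)/(2 s) + o(1/s)\<close>. With \<open>A = -y\<close>, \<open>B = y\<close> and inverse slopes \<open>(1 + e) s\<close>,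
  \<open>(1 - e) s\<close>, the leading terms cancel, and the next ones give
  \<open>p(-y) + p(y) \<le> p(-y)/(1 + e) + p(y)/(1 - e)\<close>; equality holds at \<open>e = 0\<close>, so the derivative
  \<open>p(y) - p(-y)\<close> vanishes and \<open>p\<close> is even. Then \<open>K\<close> is even in \<open>x\<close>, and the inequality with \<open>A = -x\<close>,
  \<open>B = y\<close> says that \<open>K\<close> is midpoint convex, at first if \<open>x + y > 0\<close> and then, by continuity and
  reflection, always. Continuity upgrades this to convexity. Finally \<open>p(x)/2\<close> is the pointwise limit
  of \<open>s (K(s, x) - s)\<close> as \<open>s\<close> grows, a limit of convex functions of \<open>x\<close>.
\<close>

section \<open>Trapezoidal functions\<close>

text \<open>The parameters \<open>r\<close> and \<open>s\<close> are inverse slopes rather than slopes: they are what symmetrization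
  averages, and what the first argument of \<^const>\<open>K\<close> stands for.\<close>

definition trapezoid :: "real \<Rightarrow> real \<Rightarrow> real \<Rightarrow> real \<Rightarrow> real \<Rightarrow> real \<Rightarrow> real" where
  "trapezoid A B r s h x = max 0 (min h (min ((x - A) / r) ((B - x) / s)))"

lemma deriv_eq_slope_of_affine_on_open:
  fixes u :: "real \<Rightarrow> real"
  assumes "open S" "x \<in> S" "\<And>y. y \<in> S \<Longrightarrow> u y = m * y + c"
  shows "deriv u x = m"
proof -
  have "((\<lambda>y. m * y + c) has_field_derivative m) (at x)"
    by (auto intro!: derivative_eq_intros)
  then have "(u has_field_derivative m) (at x)"
    by (rule has_field_derivative_transform_within_open) (use assms in auto)
  then show ?thesis by (rule DERIV_imp_deriv)
qed

locale trapezoid_params =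
  fixes A B r s h :: real
  assumes r: "r > 0" and s: "s > 0" and h: "h > 0" and fits: "A + r * h \<le> B - s * h"
begin

lemma rh: "0 < r * h" and sh: "0 < s * h"
  using r s h by auto

lemma trapezoid_left: "x \<le> A \<Longrightarrow> trapezoid A B r s h x = 0"
  using divide_nonpos_pos[of "x - A" r] r by (simp add: trapezoid_def min_le_iff_disj)

lemma trapezoid_right: "B \<le> x \<Longrightarrow> trapezoid A B r s h x = 0"
  using divide_nonpos_pos[of "B - x" s] s by (simp add: trapezoid_def min_le_iff_disj)

lemma trapezoid_up:
  assumes "A \<le> x" "x \<le> A + r * h" shows "trapezoid A B r s h x = (x - A) / r"
proof -
  have "(x - A) / r \<le> h" using assms r by (simp add: field_simps)
  moreover have "0 \<le> (x - A) / r" using assms r by simp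
  moreover have "h \<le> (B - x) / s" using assms s fits by (simp add: field_simps)
  ultimately show ?thesis by (simp add: trapezoid_def)
qed

lemma trapezoid_down:
  assumes "B - s * h \<le> x" "x \<le> B" shows "trapezoid A B r s h x = (B - x) / s"
proof -
  have "(B - x) / s \<le> h" using assms s by (simp add: field_simps)
  moreover have "0 \<le> (B - x) / s" using assms s by simp
  moreover have "h \<le> (x - A) / r" using assms r fits by (simp add: field_simps)
  ultimately show ?thesis by (simp add: trapezoid_def)
qed

lemma trapezoid_top:
  assumes "A + r * h \<le> x" "x \<le> B - s * h" shows "trapezoid A B r s h x = h"
proof -
  have "h \<le> (B - x) / s" using assms s by (simp add: field_simps)
  moreover have "h \<le> (x - A) / r" using assms r by (simp add: field_simps)
  ultimately show ?thesis using h by (simp add: trapezoid_def)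
qed

lemma deriv_trapezoid:
  "x < A \<Longrightarrow> deriv (trapezoid A B r s h) x = 0"
  "A < x \<Longrightarrow> x < A + r * h \<Longrightarrow> deriv (trapezoid A B r s h) x = 1 / r"
  "A + r * h < x \<Longrightarrow> x < B - s * h \<Longrightarrow> deriv (trapezoid A B r s h) x = 0"
  "B - s * h < x \<Longrightarrow> x < B \<Longrightarrow> deriv (trapezoid A B r s h) x = - 1 / s"
  "B < x \<Longrightarrow> deriv (trapezoid A B r s h) x = 0"
proof -
  show "x < A \<Longrightarrow> deriv (trapezoid A B r s h) x = 0"
    by (rule deriv_eq_slope_of_affine_on_open[of "{..<A}" _ _ _ 0]) (auto simp: trapezoid_left)
  show "A < x \<Longrightarrow> x < A + r * h \<Longrightarrow> deriv (trapezoid A B r s h) x = 1 / r"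
    by (rule deriv_eq_slope_of_affine_on_open[of "{A<..<A + r * h}" _ _ _ "- A / r"])
      (auto simp: trapezoid_up diff_divide_distrib)
  show "A + r * h < x \<Longrightarrow> x < B - s * h \<Longrightarrow> deriv (trapezoid A B r s h) x = 0"
    by (rule deriv_eq_slope_of_affine_on_open[of "{A + r * h<..<B - s * h}" _ _ _ h])
      (auto simp: trapezoid_top)
  show "B - s * h < x \<Longrightarrow> x < B \<Longrightarrow> deriv (trapezoid A B r s h) x = - 1 / s"
    by (rule deriv_eq_slope_of_affine_on_open[of "{B - s * h<..<B}" _ _ _ "B / s"])
      (auto simp: trapezoid_down diff_divide_distrib)
  show "B < x \<Longrightarrow> deriv (trapezoid A B r s h) x = 0"
    by (rule deriv_eq_slope_of_affine_on_open[of "{B<..}" _ _ _ 0]) (auto simp: trapezoid_right)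
qed

lemma trapezoid_gt_iff:
  assumes "0 \<le> t"
  shows "t < trapezoid A B r s h x \<longleftrightarrow> t < h \<and> A + r * t < x \<and> x < B - s * t"
  using assms r s by (auto simp: trapezoid_def less_max_iff_disj field_simps)

lemma continuous_on_trapezoid: "continuous_on S (trapezoid A B r s h)"
proof -
  have "continuous_on S (\<lambda>x. max 0 (min h (min ((x - A) / r) ((B - x) / s))))"
    using r s by (intro continuous_intros) auto
  then show ?thesis by (simp add: trapezoid_def[abs_def])
qed

lemma piecewise_linear_trapezoid:
  assumes "-1 \<le> A" "B \<le> 1"
  shows "piecewise_linear_on (-1) 1 (trapezoid A B r s h)"
proof -
  let ?u = "trapezoid A B r s h"
  let ?D = "{{-1..A}, {A..A + r * h}, {A + r * h..B - s * h}, {B - s * h..B}, {B..1}}"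
  have "?D division_of {-1..1}"
  proof (rule division_ofI)
    show "\<And>K. K \<in> ?D \<Longrightarrow> \<exists>a b. K = cbox a b" by (auto simp: cbox_interval) 
    show "interior J \<inter> interior L = {}" if "J \<in> ?D" "L \<in> ?D" "J \<noteq> L" for J L
      using that rh sh fits by auto
    show "\<Union>?D = {-1..1}" using assms rh sh fits by auto
  qed (use assms rh sh fits in auto)
  moreover have "\<exists>m c. \<forall>x\<in>J. ?u x = m * x + c" if "J \<in> ?D" for J
  proof -
    from that consider "J = {-1..A}" | "J = {A..A + r * h}" | "J = {A + r * h..B - s * h}"
      | "J = {B - s * h..B}" | "J = {B..1}" by blast
    then show ?thesis
    proof cases
      case 1 then show ?thesis by (intro exI[of _ 0]) (auto simp: trapezoid_left)
    next
      case 2 then show ?thesis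
        by (intro exI[of _ "1 / r"] exI[of _ "- A / r"]) (auto simp: trapezoid_up diff_divide_distrib)
    next
      case 3 then show ?thesis by (intro exI[of _ 0] exI[of _ h]) (auto simp: trapezoid_top)
    next
      case 4 then show ?thesis
        by (intro exI[of _ "- 1 / s"] exI[of _ "B / s"]) (auto simp: trapezoid_down diff_divide_distrib)
    next
      case 5 then show ?thesis by (intro exI[of _ 0]) (auto simp: trapezoid_right)
    qed
  qed
  ultimately show ?thesis
    unfolding piecewise_linear_on_def
    by (intro conjI continuous_on_trapezoid exI[of _ ?D] ballI)
qed

text \<open>A Lipschitz bound suffices for absolute continuity, and it is immediate from the formula by
  maxima and minima, which are nonexpansive operations.\<close>

lemma lipschitz_trapezoid:
  "\<bar>trapezoid A B r s h x - trapezoid A B r s h y\<bar> \<le> (1 / r + 1 / s) * \<bar>x - y\<bar>"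
proof -
  have clamp: "\<bar>max 0 a - max 0 b\<bar> \<le> \<bar>a - b\<bar>" "\<bar>min h a - min h b\<bar> \<le> \<bar>a - b\<bar>" for a b :: real
    by (simp_all add: max_def min_def)
  have min2: "\<bar>min a c - min b d\<bar> \<le> max \<bar>a - b\<bar> \<bar>c - d\<bar>" for a b c d :: real
    by (auto simp: max_def min_def)
  have "\<bar>trapezoid A B r s h x - trapezoid A B r s h y\<bar>
      \<le> max \<bar>(x - A) / r - (y - A) / r\<bar> \<bar>(B - x) / s - (B - y) / s\<bar>"
    unfolding trapezoid_def by (rule order_trans[OF clamp(1) order_trans[OF clamp(2) min2]])
  also have "\<dots> = max (\<bar>x - y\<bar> / r) (\<bar>x - y\<bar> / s)"
    using r s by (simp add: diff_divide_distrib[symmetric] abs_minus_commute)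
  also have "\<dots> \<le> \<bar>x - y\<bar> / r + \<bar>x - y\<bar> / s"
    using r s by simp
  finally show ?thesis by (simp add: algebra_simps)
qed

end

lemma abs_continuous_on_if_lipschitz:
  fixes u :: "real \<Rightarrow> real"
  assumes "\<And>x y. \<bar>u x - u y\<bar> \<le> L * \<bar>x - y\<bar>"
  shows "abs_continuous_on a b u"
  unfolding abs_continuous_on_def
proof (intro allI impI)
  fix \<epsilon> :: real assume "\<epsilon> > 0"
  have L: "0 \<le> L" using assms[of 1 0] by simp
  show "\<exists>\<delta>>0. \<forall>\<D>. \<D> division_of \<Union>\<D> \<and> \<Union>\<D> \<subseteq> {a..b} \<and> (\<Sum>J\<in>\<D>. Sup J - Inf J) < \<delta>
        \<longrightarrow> (\<Sum>J\<in>\<D>. \<bar>u (Sup J) - u (Inf J)\<bar>) < \<epsilon>"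
  proof (intro exI[of _ "\<epsilon> / (L + 1)"] conjI allI impI; (elim conjE)?)
    show "0 < \<epsilon> / (L + 1)" using \<open>\<epsilon> > 0\<close> L by simp
    fix \<D> :: "real set set"
    assume D: "\<D> division_of \<Union>\<D>" and len: "(\<Sum>J\<in>\<D>. Sup J - Inf J) < \<epsilon> / (L + 1)"
    have ord: "Inf J \<le> Sup J" if "J \<in> \<D>" for J
    proof -
      have "J \<noteq> {}" "\<exists>c d. J = {c..d}"
        using division_ofD(3,4)[OF D that] by (simp_all add: cbox_interval)
      then show ?thesis by auto
    qed
    have "(\<Sum>J\<in>\<D>. \<bar>u (Sup J) - u (Inf J)\<bar>) \<le> (\<Sum>J\<in>\<D>. L * (Sup J - Inf J))"
      by (rule sum_mono) (use assms ord in \<open>smt (verit)\<close>)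
    also have "\<dots> = L * (\<Sum>J\<in>\<D>. Sup J - Inf J)" by (simp add: sum_distrib_left)
    also have "\<dots> \<le> (L + 1) * (\<Sum>J\<in>\<D>. Sup J - Inf J)"
      using ord by (intro mult_right_mono sum_nonneg) auto
    also have "\<dots> < \<epsilon>" using len L by (simp add: field_simps)
    finally show "(\<Sum>J\<in>\<D>. \<bar>u (Sup J) - u (Inf J)\<bar>) < \<epsilon>" .
  qed
qed

context trapezoid_params
begin

lemma trapezoid_in_W11_zero:
  assumes "-1 \<le> A" "B \<le> 1"
  shows "trapezoid A B r s h \<in> W11_zero"
proof -
  let ?u = "trapezoid A B r s h"
  have piece: "deriv ?u absolutely_integrable_on {a..b}"
    if "\<And>x. a < x \<Longrightarrow> x < b \<Longrightarrow> deriv ?u x = m" for a b m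
  proof (rule absolutely_integrable_spike[where f = "\<lambda>x. m" and S = "{a, b}"])
    show "(\<lambda>x. m) absolutely_integrable_on {a..b}"
      by (intro absolutely_integrable_continuous_real continuous_intros)
  qed (use that in auto)
  have "deriv ?u absolutely_integrable_on {-1..1}"
    using rh sh fits assms
    by (intro absolutely_integrable_on_combine[OF
          absolutely_integrable_on_combine[OF
            absolutely_integrable_on_combine[OF
              absolutely_integrable_on_combine[OF
                piece[of "-1" A 0] piece[of A "A + r * h" "1 / r"]]
              piece[of "A + r * h" "B - s * h" 0]]
            piece[of "B - s * h" B "- 1 / s"]]
          piece[of B 1 0]])
      (auto simp: deriv_trapezoid)
  then show ?thesis
    unfolding W11_zero_def
    using abs_continuous_on_if_lipschitz[OF lipschitz_trapezoid] assms
    by (auto simp: trapezoid_left trapezoid_right)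
qed

text \<open>The superlevel set at height \<open>t < h\<close> has half-length \<open>(B - A)/2 - (r + s)/2 * t\<close>, so a point \<open>x\<close>
  lies in the symmetrized set exactly for \<open>t < h\<close> and \<open>t \<le> ((B - A)/2 - \<bar>x\<bar>) / ((r + s)/2)\<close>. The
  layer-cake integral is the length of this range of \<open>t\<close>, which is a trapezoid as a function of \<open>x\<close>.\<close>

lemma symmetrization_trapezoid:
  assumes "-1 \<le> A" "B \<le> 1"
  shows "symmetrization (trapezoid A B r s h)
    = trapezoid (- ((B - A) / 2)) ((B - A) / 2) ((r + s) / 2) ((r + s) / 2) h"
proof
  fix x :: real
  let ?u = "trapezoid A B r s h"
  let ?m = "(r + s) / 2" and ?l = "(B - A) / 2"
  let ?c = "(?l - \<bar>x\<bar>) / ?m"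
  have symm: "symm_set (superlevel ?u t) = (if t < h then {- (?l - ?m * t)..?l - ?m * t} else {})"
    if t: "0 \<le> t" for t
  proof (cases "t < h")
    case True
    have lt: "A + r * t < B - s * t"
      using True r s fits by (smt (verit, best) mult_strict_left_mono)
    have "superlevel ?u t = {A + r * t<..<B - s * t}"
    proof -
      have "0 \<le> r * t" "0 \<le> s * t" using r s t by simp_all
      then show ?thesis
        using True assms by (auto simp: superlevel_def trapezoid_gt_iff[OF t])
    qed
    moreover have "measure lebesgue {A + r * t<..<B - s * t} = 2 * (?l - ?m * t)"
      using lt by (simp add: field_simps)
    ultimately show ?thesis using True lt by (simp add: symm_set_def)
  next
    case False
    then have "superlevel ?u t = {}"
      by (auto simp: superlevel_def trapezoid_gt_iff[OF t])
    with False show ?thesis by (simp add: symm_set_def)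
  qed
  have m: "?m > 0" using r s by simp
  have mem: "x \<in> {- (?l - ?m * t)..?l - ?m * t} \<longleftrightarrow> t \<le> ?c" for t
  proof -
    have "x \<in> {- a..a} \<longleftrightarrow> \<bar>x\<bar> \<le> a" for a by auto
    moreover have "t \<le> ?c \<longleftrightarrow> ?m * t \<le> ?l - \<bar>x\<bar>"
      by (simp only: pos_le_divide_eq[OF m] mult.commute)
    ultimately show ?thesis by (simp only: le_diff_eq add.commute)
  qed
  have "x \<in> symm_set (superlevel ?u t) \<longleftrightarrow> t < h \<and> t \<le> ?c" if "0 \<le> t" for t
    by (cases "t < h") (simp_all only: symm[OF that] mem if_True if_False empty_iff simp_thms)
  then have "indicat_real (symm_set (superlevel ?u t)) x * indicat_real {0..} t
      = indicat_real ({0..<h} \<inter> {..?c}) t" for t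
    by (auto simp: indicator_def)
  then have "symmetrization ?u x = integral\<^sup>L lebesgue (indicat_real ({0..<h} \<inter> {..?c}))"
    unfolding symmetrization_def set_lebesgue_integral_def
    by (intro Bochner_Integration.integral_cong) (auto simp: mult.commute)
  also have "\<dots> = measure lebesgue ({0..<h} \<inter> {..?c})" by simp
  also have "{0..<h} \<inter> {..?c} = (if ?c < h then {0..?c} else {0..<h})" by auto
  \<comment> \<open>\<open>?c\<close> is negative outside the symmetrized support; the interval is then empty.\<close>
  also have "measure lebesgue \<dots> = max 0 (min h ?c)" using h by auto
  also have "\<dots> = trapezoid (- ?l) ?l ?m ?m h x"
  proof -
    have "min ((x - - l) / q) ((l - x) / q) = (l - \<bar>x\<bar>) / q" if "q > 0" for l q :: real
      using that by (auto simp: min_def abs_if field_simps mult_le_0_iff)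
    from this[OF m] show ?thesis by (simp only: trapezoid_def)
  qed
  finally show "symmetrization ?u x = trapezoid (- ?l) ?l ?m ?m h x" .
qed

text \<open>The energy is expressed by antiderivatives \<open>F\<close>, \<open>G\<close> of the two densities on all of \<open>[-1,1]\<close>,
  independent of \<open>h\<close>, so that it can be differentiated in \<open>h\<close>. The nonnegativity claim
  allows an inequality between energies in \<open>[0,\<infinity>]\<close> to be read as one between real numbers.\<close>

lemma energy_trapezoid:
  assumes "-1 \<le> A" "B \<le> 1"
    and F: "\<And>x. x \<in> {-1..1} \<Longrightarrow>
      (F has_real_derivative (1 + (1 / r)\<^sup>2) powr (p x / 2)) (at x within {-1..1})"
    and G: "\<And>x. x \<in> {-1..1} \<Longrightarrow>
      (G has_real_derivative (1 + (1 / s)\<^sup>2) powr (p x / 2)) (at x within {-1..1})"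
  shows "energy p (trapezoid A B r s h)
    = ennreal (2 - (r + s) * h + (F (A + r * h) - F A) + (G B - G (B - s * h)))" (is "_ = ennreal ?E")
    and "0 \<le> 2 - (r + s) * h + (F (A + r * h) - F A) + (G B - G (B - s * h))"
proof -
  let ?u = "trapezoid A B r s h"
  let ?f = "\<lambda>x. (1 + (deriv ?u x)\<^sup>2) powr (p x / 2)"
  have piece: "(?f has_integral H b - H a) {a..b}"
    if "a \<le> b" "-1 \<le> a" "b \<le> 1" "\<And>x. a < x \<Longrightarrow> x < b \<Longrightarrow> ?f x = g x"
      "\<And>x. x \<in> {-1..1} \<Longrightarrow> (H has_real_derivative g x) (at x within {-1..1})" for a b g H
  proof (rule has_integral_spike_finite[of "{a, b}" _ _ g])
    show "(g has_integral H b - H a) {a..b}"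
    proof (rule fundamental_theorem_of_calculus)
      fix x assume "x \<in> {a..b}"
      then show "(H has_vector_derivative g x) (at x within {a..b})"
        using that(2,3) that(5)[of x]
        by (auto simp flip: has_real_derivative_iff_has_vector_derivative
            intro: DERIV_subset[of _ _ _ "{-1..1}"])
    qed fact
  qed (use that in auto)
  note flat = piece[where g = "\<lambda>x. 1" and H = "\<lambda>x. x"]
  have ends: "-1 \<le> A + r * h" "A + r * h \<le> 1" "-1 \<le> B - s * h" "B - s * h \<le> 1" "A \<le> 1" "-1 \<le> B"
    using rh sh fits assms by auto
  have 1: "(?f has_integral A - (-1)) {-1..A}"
    by (rule flat) (use ends assms in \<open>auto simp: deriv_trapezoid\<close>)
  have 2: "(?f has_integral F (A + r * h) - F A) {A..A + r * h}"
    by (rule piece[OF _ _ _ _ F]) (use ends rh assms in \<open>auto simp: deriv_trapezoid\<close>)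
  have 3: "(?f has_integral B - s * h - (A + r * h)) {A + r * h..B - s * h}"
    by (rule flat) (use ends fits assms in \<open>auto simp: deriv_trapezoid\<close>)
  have 4: "(?f has_integral G B - G (B - s * h)) {B - s * h..B}"
    by (rule piece[OF _ _ _ _ G]) (use ends sh assms in \<open>auto simp: deriv_trapezoid\<close>)
  have 5: "(?f has_integral 1 - B) {B..1}"
    by (rule flat) (use ends assms in \<open>auto simp: deriv_trapezoid\<close>)
  have "(?f has_integral A - (-1) + (F (A + r * h) - F A) + (B - s * h - (A + r * h))
      + (G B - G (B - s * h)) + (1 - B)) {-1..1}"
    using ends rh sh fits assms(1,2)
    by (intro has_integral_combine[OF _ _
          has_integral_combine[OF _ _
            has_integral_combine[OF _ _
              has_integral_combine[OF _ _ 1 2] 3] 4] 5]) auto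
  then have I: "(?f has_integral ?E) {-1..1}" by (simp add: algebra_simps)
  show "energy p ?u = ennreal ?E"
    unfolding energy_def nn_integral_completion power2_abs
    by (rule nn_integral_has_integral_lebesgue'[OF _ I]) simp
  show "0 \<le> ?E" using I by (rule has_integral_nonneg) simp
qed

end

section \<open>The infinitesimal inequality\<close>

lemma one_sided_derivative_nonneg:
  fixes f :: "real \<Rightarrow> real"
  assumes "(f has_real_derivative d) (at 0 within {0..\<eta>})" "\<eta> > 0" "f 0 = 0"
    "\<And>h. 0 < h \<Longrightarrow> h \<le> \<eta> \<Longrightarrow> 0 \<le> f h"
  shows "0 \<le> d"
proof (rule tendsto_lowerbound)
  show "((\<lambda>h. (f h - f 0) / (h - 0)) \<longlongrightarrow> d) (at 0 within {0..\<eta>})"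
    using assms(1) by (simp add: has_field_derivative_iff)
  show "\<forall>\<^sub>F h in at 0 within {0..\<eta>}. 0 \<le> (f h - f 0) / (h - 0)"
    unfolding eventually_at_filter using assms(3,4) by (auto intro!: always_eventually divide_nonneg_pos)
  show "at 0 within {0..\<eta>} \<noteq> bot"
    using \<open>\<eta> > 0\<close> by (simp add: trivial_limit_within islimpt_Icc)
qed

lemma DERIV_compose_affine_at_0:
  fixes F :: "real \<Rightarrow> real"
  assumes "(F has_real_derivative d) (at c within S)" "\<And>h. h \<in> T \<Longrightarrow> c + k * h \<in> S"
  shows "((\<lambda>h. F (c + k * h)) has_real_derivative k * d) (at 0 within T)"
proof -
  have "((\<lambda>h. c + k * h) has_real_derivative k) (at 0 within T)"
    by (auto intro!: derivative_eq_intros)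
  moreover have "(F has_real_derivative d) (at (c + k * 0) within (\<lambda>h. c + k * h) ` T)"
    by (simp, rule DERIV_subset[OF assms(1)]) (use assms(2) in auto)
  ultimately show ?thesis
    using DERIV_image_chain[of F d "\<lambda>h. c + k * h" 0 T k] by (simp add: o_def mult.commute)
qed

text \<open>The second factor is the energy density at \<open>x\<close> of a function with slope \<open>1/s\<close> there.\<close>

lemma K_alt: "K p s x = s * (1 + (1 / s)\<^sup>2) powr (p x / 2)"
  by (simp add: K_def power_int_minus power_one_over inverse_eq_divide)

text \<open>The energies of a trapezoid and of its symmetrization, as functions of the height \<open>h\<close>, agree at
  \<open>h = 0\<close> and are ordered for \<open>h > 0\<close>; hence so are their right derivatives at \<open>0\<close>. The energy of
  the trapezoid has derivative \<open>K(r, A) + K(s, B) - (r + s)\<close>, and the subtracted term is the same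
  for the symmetrization.\<close>

lemma K_inequality_of_symmetrization:
  fixes p :: "real \<Rightarrow> real"
  assumes p: "continuous_on {-1..1} p"
    and symm: "\<And>u. piecewise_linear_on (-1) 1 u \<Longrightarrow> u \<in> W11_zero \<Longrightarrow> (\<forall>x\<in>{-1..1}. u x \<ge> 0)
           \<Longrightarrow> energy p (symmetrization u) \<le> energy p u"
    and AB: "-1 \<le> A" "A < B" "B \<le> 1" and r: "r > 0" and s: "s > 0"
  shows "K p ((r + s) / 2) (- (B - A) / 2) + K p ((r + s) / 2) ((B - A) / 2) \<le> K p r A + K p s B"
proof -
  let ?g = "\<lambda>q x. (1 + (1 / q)\<^sup>2) powr (p x / 2)"
  let ?m = "(r + s) / 2" and ?l = "(B - A) / 2"
  have "\<exists>F. \<forall>x\<in>{-1..1}. (F has_real_derivative ?g q x) (at x within {-1..1})" for q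
  proof -
    have "1 + (1 / q)\<^sup>2 \<noteq> 0" by (smt (verit) zero_le_power2)
    then have "continuous_on {-1..1} (?g q)"
      by (intro continuous_intros p) auto
    from antiderivative_continuous[OF this] show ?thesis
      by (metis has_real_derivative_iff_has_vector_derivative)
  qed
  then obtain F where
    F: "\<And>q x. x \<in> {-1..1} \<Longrightarrow> (F q has_real_derivative ?g q x) (at x within {-1..1})"
    by metis
  define E where "E A B r s h =
    2 - (r + s) * h + (F r (A + r * h) - F r A) + (F s B - F s (B - s * h))" for A B r s h
  \<comment> \<open>The largest height for which the two sloped sides do not overlap; it depends only on \<open>B - A\<close>
    and \<open>r + s\<close>, which the symmetrization preserves.\<close>
  define \<eta> where "\<eta> = (B - A) / (r + s)"
  have \<eta>: "\<eta> > 0" using AB r s by (simp add: \<eta>_def)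
  have fits: "A' + r' * h \<le> B' - s' * h"
    if "0 \<le> h" "h \<le> \<eta>" "B' - A' = B - A" "r' + s' = r + s" for A' B' r' s' h
  proof -
    have "(r + s) * h \<le> B - A" using that r s by (simp add: \<eta>_def field_simps)
    then have "r' * h + s' * h \<le> B' - A'"
      using that(3) by (simp only: that(4) flip: distrib_right)
    then show ?thesis by simp
  qed
  have E_le: "E (- ?l) ?l ?m ?m h \<le> E A B r s h" if h: "0 < h" "h \<le> \<eta>" for h
  proof -
    interpret u: trapezoid_params A B r s h
      by standard (use r s h fits[of h B A r s] in auto)
    interpret v: trapezoid_params "- ?l" ?l ?m ?m h
      by standard (use r s h fits[of h ?l "- ?l" ?m ?m] in \<open>auto simp: field_simps\<close>)
    have "energy p (trapezoid (- ?l) ?l ?m ?m h) \<le> energy p (trapezoid A B r s h)"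
      using symm[OF u.piecewise_linear_trapezoid u.trapezoid_in_W11_zero] AB
      by (simp add: u.symmetrization_trapezoid trapezoid_def)
    moreover have "energy p (trapezoid A B r s h) = ennreal (E A B r s h)" "0 \<le> E A B r s h"
      unfolding E_def by (rule u.energy_trapezoid[OF _ _ F F]; use AB in simp)+
    moreover have "energy p (trapezoid (- ?l) ?l ?m ?m h) = ennreal (E (- ?l) ?l ?m ?m h)"
      unfolding E_def by (rule v.energy_trapezoid[OF _ _ F F]; use AB in simp)
    ultimately show ?thesis by simp
  qed
  have E_deriv: "(E A' B' r' s' has_real_derivative K p r' A' + K p s' B' - (r + s)) (at 0 within {0..\<eta>})"
    if "-1 \<le> A'" "B' \<le> 1" "B' - A' = B - A" "r' + s' = r + s" "r' > 0" "s' > 0" for A' B' r' s'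
  proof -
    have "((\<lambda>h. F r' (A' + r' * h)) has_real_derivative r' * ?g r' A') (at 0 within {0..\<eta>})"
    proof (rule DERIV_compose_affine_at_0[OF F])
      fix h assume h: "h \<in> {0..\<eta>}"
      then have "0 \<le> s' * h" "0 \<le> r' * h" using that by auto
      moreover have "A' + r' * h \<le> B' - s' * h" using h that by (intro fits) auto
      ultimately show "A' + r' * h \<in> {-1..1}"
        unfolding atLeastAtMost_iff using that(1,2) by (intro conjI; linarith)
    qed (use that AB in auto)
    moreover have "((\<lambda>h. F s' (B' + (- s') * h)) has_real_derivative (- s') * ?g s' B') (at 0 within {0..\<eta>})"
    proof (rule DERIV_compose_affine_at_0[OF F])
      fix h assume h: "h \<in> {0..\<eta>}"
      then have "0 \<le> s' * h" "0 \<le> r' * h" using that by auto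
      moreover have "A' + r' * h \<le> B' - s' * h" using h that by (intro fits) auto
      ultimately show "B' + (- s') * h \<in> {-1..1}"
        unfolding atLeastAtMost_iff using that(1,2) by (intro conjI; linarith)
    qed (use that AB in auto)
    ultimately show ?thesis
      unfolding E_def K_alt using that(4)
      by (auto intro!: derivative_eq_intros)
  qed
  have "((\<lambda>h. E A B r s h - E (- ?l) ?l ?m ?m h) has_real_derivative
      (K p r A + K p s B - (r + s)) - (K p ?m (- ?l) + K p ?m ?l - (r + s))) (at 0 within {0..\<eta>})"
    using AB r s by (intro DERIV_diff E_deriv) auto
  then have "0 \<le> (K p r A + K p s B - (r + s)) - (K p ?m (- ?l) + K p ?m ?l - (r + s))"
  proof (rule one_sided_derivative_nonneg[OF _ \<eta>])
    show "E A B r s 0 - E (- ?l) ?l ?m ?m 0 = 0" by (simp add: E_def)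
    show "0 \<le> E A B r s h - E (- ?l) ?l ?m ?m h" if "0 < h" "h \<le> \<eta>" for h
      using E_le[OF that] by simp
  qed
  then show ?thesis unfolding minus_divide_left by linarith
qed

section \<open>Evenness and convexity\<close>

text \<open>This is the expansion \<open>K(s, x) = s + p(x)/(2 s) + o(1/s)\<close> at infinity, from which both
  evenness and convexity of \<open>p\<close> are read off. The factor \<open>c\<close> lets different inverse slopes tend to
  infinity at a fixed ratio.\<close>

lemma K_asymptotics:
  assumes "c > 0"
  shows "((\<lambda>s. s * (K p (c * s) x - c * s)) \<longlongrightarrow> p x / 2 / c) at_top"
proof -
  have "((\<lambda>s::real. s * (c * s * (1 + (1 / (c * s))\<^sup>2) powr q - c * s)) \<longlongrightarrow> q / c) at_top" for q
    using assms by real_asymp (simp add: power2_eq_square field_simps)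
  from this[of "p x / 2"] show ?thesis by (simp only: K_alt)
qed

text \<open>Take the inverse slopes \<open>(1 + e) q\<close> and \<open>(1 - e) q\<close>, whose mean is \<open>q\<close>, and let \<open>q\<close> go to
  infinity. The terms of order \<open>q\<close> cancel, and those of order \<open>1/q\<close> give
  \<open>p(-y) + p(y) \<le> p(-y)/(1 + e) + p(y)/(1 - e)\<close>. The two sides agree at \<open>e = 0\<close>, an interior
  minimum of their difference, so its derivative \<open>p(y) - p(-y)\<close> there must vanish.\<close>

lemma even_of_K_inequality:
  fixes p :: "real \<Rightarrow> real"
  assumes "\<And>r s. r > 0 \<Longrightarrow> s > 0 \<Longrightarrow>
      K p ((r + s) / 2) (- y) + K p ((r + s) / 2) y \<le> K p r (- y) + K p s y"
  shows "p (- y) = p y"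
proof -
  let ?a = "p (- y)" and ?b = "p y"
  have ineq: "?a + ?b \<le> ?a / (1 + e) + ?b / (1 - e)" if "\<bar>e\<bar> < 1" for e
  proof -
    have "?a / 2 / 1 + ?b / 2 / 1 \<le> ?a / 2 / (1 + e) + ?b / 2 / (1 - e)"
    proof (rule tendsto_le[OF _ tendsto_add tendsto_add])
      show "((\<lambda>s. s * (K p (1 * s) (- y) - 1 * s)) \<longlongrightarrow> ?a / 2 / 1) at_top"
        "((\<lambda>s. s * (K p (1 * s) y - 1 * s)) \<longlongrightarrow> ?b / 2 / 1) at_top"
        "((\<lambda>s. s * (K p ((1 + e) * s) (- y) - (1 + e) * s)) \<longlongrightarrow> ?a / 2 / (1 + e)) at_top"
        "((\<lambda>s. s * (K p ((1 - e) * s) y - (1 - e) * s)) \<longlongrightarrow> ?b / 2 / (1 - e)) at_top"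
        using that by (intro K_asymptotics; simp)+
      show "\<forall>\<^sub>F s in at_top. s * (K p (1 * s) (- y) - 1 * s) + s * (K p (1 * s) y - 1 * s)
          \<le> s * (K p ((1 + e) * s) (- y) - (1 + e) * s) + s * (K p ((1 - e) * s) y - (1 - e) * s)"
        using eventually_gt_at_top[of 0]
      proof eventually_elim
        case (elim s)
        have "((1 + e) * s + (1 - e) * s) / 2 = s" by (simp add: field_simps)
        then have "K p s (- y) + K p s y \<le> K p ((1 + e) * s) (- y) + K p ((1 - e) * s) y"
          using assms[of "(1 + e) * s" "(1 - e) * s"] elim that by simp
        from mult_left_mono[OF this, of s] elim show ?case by (simp add: algebra_simps)
      qed
    qed simp
    also have "\<dots> = (?a / (1 + e) + ?b / (1 - e)) / 2"
      by (simp add: add_divide_distrib mult.commute)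
    finally show ?thesis by simp
  qed
  \<comment> \<open>Multiplying by \<open>1 - e\<^sup>2\<close> clears the denominators.\<close>
  have ineq': "0 \<le> e * (?b - ?a) + e\<^sup>2 * (?a + ?b)" if "\<bar>e\<bar> < 1" for e
  proof -
    have pos: "0 < 1 + e" "0 < 1 - e" using that by auto
    have "(?a + ?b) * ((1 + e) * (1 - e)) \<le> (?a / (1 + e) + ?b / (1 - e)) * ((1 + e) * (1 - e))"
      using pos by (intro mult_right_mono ineq that) auto
    also have "\<dots> = ?a * (1 - e) + ?b * (1 + e)"
    proof -
      have "z / (1 + e) * ((1 + e) * (1 - e)) = z * (1 - e)"
        "z / (1 - e) * ((1 + e) * (1 - e)) = z * (1 + e)" for z
        using pos by simp_all
      then show ?thesis by (simp only: distrib_right)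
    qed
    finally show ?thesis by (simp add: algebra_simps power2_eq_square)
  qed
  have "((\<lambda>e. (e * (?b - ?a) + e\<^sup>2 * (?a + ?b))) has_real_derivative (?b - ?a)) (at 0 within {0..1/2})"
    by (auto intro!: derivative_eq_intros)
  then have "0 \<le> ?b - ?a"
    by (rule one_sided_derivative_nonneg) (use ineq' in auto)
  moreover have "((\<lambda>e. (- e * (?b - ?a) + e\<^sup>2 * (?a + ?b))) has_real_derivative (?a - ?b)) (at 0 within {0..1/2})"
    by (auto intro!: derivative_eq_intros)
  then have "0 \<le> ?a - ?b"
    by (rule one_sided_derivative_nonneg) (use ineq'[of "- e" for e] in auto)
  ultimately show ?thesis by simp
qed

text \<open>On a segment, subtract the affine interpolation of the end values. If the difference were
  positive somewhere, take the first point at which it attains its maximum: it is the midpoint of a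
  short segment at whose left end the value is strictly smaller and at whose right end it is no
  larger, against midpoint convexity.\<close>

lemma convex_on_if_midpoint_convex:
  fixes f :: "'a::real_normed_vector \<Rightarrow> real"
  assumes S: "convex S" and f: "continuous_on S f"
    and mid: "\<And>x y. x \<in> S \<Longrightarrow> y \<in> S \<Longrightarrow> f ((1 / 2) *\<^sub>R (x + y)) \<le> (f x + f y) / 2"
  shows "convex_on S f"
proof (rule convex_onI[OF _ S])
  fix t :: real and x y assume t: "0 < t" "t < 1" and xy: "x \<in> S" "y \<in> S"
  define z where "z t = (1 - t) *\<^sub>R x + t *\<^sub>R y" for t
  define \<phi> where "\<phi> t = f (z t) - ((1 - t) * f x + t * f y)" for t
  have zS: "z t \<in> S" if "t \<in> {0..1}" for t
    using convexD_alt[OF S xy] that by (simp add: z_def)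
  have cont: "continuous_on {0..1} \<phi>"
    unfolding \<phi>_def using zS
    by (intro continuous_intros continuous_on_compose2[OF f]) (auto simp: z_def intro!: continuous_intros)
  have mid_\<phi>: "\<phi> ((a + b) / 2) \<le> (\<phi> a + \<phi> b) / 2" if "a \<in> {0..1}" "b \<in> {0..1}" for a b
  proof -
    have "z ((a + b) / 2) = (1 / 2) *\<^sub>R (z a + z b)"
    proof -
      have "(1 / 2) *\<^sub>R (z a + z b) = ((1 - a) / 2 + (1 - b) / 2) *\<^sub>R x + (a / 2 + b / 2) *\<^sub>R y"
        unfolding z_def by (simp add: scaleR_add_right scaleR_add_left)
      moreover have "(1 - a) / 2 + (1 - b) / 2 = 1 - (a + b) / 2" "a / 2 + b / 2 = (a + b) / 2"
        by (simp_all add: field_simps)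
      ultimately show ?thesis by (simp add: z_def)
    qed
    then have "f (z ((a + b) / 2)) \<le> (f (z a) + f (z b)) / 2"
      using mid[OF zS zS, OF that] by simp
    then show ?thesis by (simp add: \<phi>_def field_simps)
  qed
  have ends: "\<phi> 0 = 0" "\<phi> 1 = 0" by (simp_all add: \<phi>_def z_def)
  obtain w where w: "w \<in> {0..1}" "\<And>t. t \<in> {0..1} \<Longrightarrow> \<phi> t \<le> \<phi> w"
    using continuous_attains_sup[OF _ _ cont] by auto
  define M where "M = {0..1} \<inter> \<phi> -` {\<phi> w}"
  have "compact M"
    unfolding M_def compact_eq_bounded_closed
    using continuous_closed_preimage[OF cont, of "{\<phi> w}"] by (auto intro: bounded_subset[of "{0..1}"])
  moreover have "M \<noteq> {}" using w by (auto simp: M_def)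
  ultimately obtain v where v: "v \<in> M" "\<And>t. t \<in> M \<Longrightarrow> v \<le> t"
    using compact_attains_inf by metis
  have v01: "v \<in> {0..1}" and vmax: "\<phi> v = \<phi> w" using v by (auto simp: M_def)
  have "\<phi> w \<le> 0"
  proof (rule ccontr)
    assume "\<not> \<phi> w \<le> 0"
    then have "v \<noteq> 0" "v \<noteq> 1" using ends vmax by auto
    define d where "d = min v (1 - v)"
    have d: "0 < d" "v - d \<in> {0..1}" "v + d \<in> {0..1}"
      using v01 \<open>v \<noteq> 0\<close> \<open>v \<noteq> 1\<close> by (auto simp: d_def)
    have "\<phi> (v - d) \<noteq> \<phi> w" using v(2)[of "v - d"] d by (auto simp: M_def)
    then have "\<phi> (v - d) < \<phi> w" using w(2)[OF d(2)] by simp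
    with mid_\<phi>[OF d(2,3)] w(2)[OF d(3)] vmax show False by simp
  qed
  with w(2)[of t] t have "\<phi> t \<le> 0" by simp
  then show "f ((1 - t) *\<^sub>R x + t *\<^sub>R y) \<le> (1 - t) * f x + t * f y" by (simp add: \<phi>_def z_def)
qed

lemma continuous_on_K:
  assumes "continuous_on {-1..1} p"
  shows "continuous_on ({0<..} \<times> {-1..1}) (\<lambda>(s, x). K p s x)"
proof -
  have "1 + (1 / q)\<^sup>2 \<noteq> (0::real)" for q by (smt (verit) zero_le_power2)
  then have "continuous_on ({0<..} \<times> {-1..1})
      (\<lambda>z. fst z * (1 + (1 / fst z)\<^sup>2) powr (p (snd z) / 2))"
    by (intro continuous_intros continuous_on_compose2[OF assms]) auto
  then show ?thesis by (simp add: K_alt case_prod_beta)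
qed

text \<open>For \<open>x + y > 0\<close> the inequality with \<open>A = -x\<close> and \<open>B = y\<close> is the claim, since \<open>K\<close> is even in its
  second argument. The case \<open>x + y = 0\<close>, where \<open>A < B\<close> fails, follows by moving both points towards
  \<open>1\<close>, which keeps them in \<open>[-1,1]\<close>; the case \<open>x + y < 0\<close> follows by reflection.\<close>

lemma midpoint_convex_K:
  fixes p :: "real \<Rightarrow> real"
  assumes cont: "continuous_on {-1..1} p"
    and even: "\<And>x. x \<in> {-1..1} \<Longrightarrow> p (- x) = p x"
    and ineq: "\<And>r s A B. r > 0 \<Longrightarrow> s > 0 \<Longrightarrow> -1 \<le> A \<Longrightarrow> A < B \<Longrightarrow> B \<le> 1 \<Longrightarrow>
      K p ((r + s) / 2) (- (B - A) / 2) + K p ((r + s) / 2) ((B - A) / 2) \<le> K p r A + K p s B"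
    and rs: "r > 0" "s > 0" and xy: "x \<in> {-1..1}" "y \<in> {-1..1}"
  shows "K p ((r + s) / 2) ((x + y) / 2) \<le> (K p r x + K p s y) / 2"
proof -
  have K_even: "K p q (- x) = K p q x" if "x \<in> {-1..1}" for q x
    using even[OF that] by (simp add: K_def)
  have pos: "K p ((r + s) / 2) ((x + y) / 2) \<le> (K p r x + K p s y) / 2"
    if "0 < x + y" "x \<in> {-1..1}" "y \<in> {-1..1}" for x y
  proof -
    have mids: "- (y - - x) / 2 = - ((x + y) / 2)" "(y - - x) / 2 = (x + y) / 2"
      by (simp_all add: field_simps)
    have "K p ((r + s) / 2) (- ((x + y) / 2)) + K p ((r + s) / 2) ((x + y) / 2)
        \<le> K p r (- x) + K p s y"
      by (rule ineq[OF rs, of "- x" y, unfolded mids]) (use that in auto)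
    then show ?thesis
      using K_even[of x r] K_even[of "(x + y) / 2" "(r + s) / 2"] that by simp
  qed
  have nonneg: "K p ((r + s) / 2) ((x + y) / 2) \<le> (K p r x + K p s y) / 2"
    if "0 \<le> x + y" and xy: "x \<in> {-1..1}" "y \<in> {-1..1}" for x y
  proof -
    let ?x = "\<lambda>e. (1 - e) * x + e" and ?y = "\<lambda>e. (1 - e) * y + e"
    have in_Icc: "(1 - e) * x + e \<in> {-1..1}" if "x \<in> {-1..1}" "e \<in> {0..1}" for x e :: real
      using convexD_alt[OF convex_real_interval(5), of x "-1" 1 1 e] that by (simp)
    have contK: "continuous_on {0..1} (\<lambda>e. K p q (g e))"
      if "q > 0" "continuous_on {0..1} g" "\<And>e. e \<in> {0..1} \<Longrightarrow> g e \<in> {-1..1}" for q g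
    proof -
      have "continuous_on {0..1} (\<lambda>e. (\<lambda>(s, x). K p s x) (q, g e))"
        by (rule continuous_on_compose2[OF continuous_on_K[OF cont]])
          (use that in \<open>auto intro!: continuous_intros\<close>)
      then show ?thesis by simp
    qed
    have "continuous_on {0..1} (\<lambda>e. (K p r (?x e) + K p s (?y e)) / 2 - K p ((r + s) / 2) ((?x e + ?y e) / 2))"
      (is "continuous_on _ ?\<psi>")
      using rs in_Icc[OF xy(1)] in_Icc[OF xy(2)]
      by (intro continuous_on_diff continuous_on_divide continuous_on_add contK) (force intro!: continuous_intros)+
    then have "(?\<psi> \<longlongrightarrow> ?\<psi> 0) (at 0 within {0..1})"
      unfolding continuous_on_def by (rule bspec) simp
    moreover have "\<forall>\<^sub>F e in at 0 within {0..1}. 0 \<le> ?\<psi> e"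
      unfolding eventually_at_filter
    proof (intro always_eventually allI impI)
      fix e :: real assume e: "e \<noteq> 0" "e \<in> {0..1}"
      have "0 \<le> (1 - e) * (x + y)" using e that by simp
      then have "0 < ?x e + ?y e" using e by (simp add: algebra_simps)
      from pos[OF this] show "0 \<le> ?\<psi> e" using in_Icc e xy by simp
    qed
    moreover have "at (0::real) within {0..1} \<noteq> bot"
      by (simp add: trivial_limit_within islimpt_Icc)
    ultimately have "0 \<le> ?\<psi> 0" by (rule tendsto_lowerbound)
    then show ?thesis by simp
  qed
  show ?thesis
  proof (cases "0 \<le> x + y")
    case True then show ?thesis using nonneg xy by simp
  next
    case False
    have mid: "(- x + - y) / 2 = - ((x + y) / 2)" by (simp add: field_simps)
    have "K p ((r + s) / 2) (- ((x + y) / 2)) \<le> (K p r (- x) + K p s (- y)) / 2"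
      by (rule nonneg[of "- x" "- y", unfolded mid]) (use False xy in auto)
    then show ?thesis
      using xy K_even[of x r] K_even[of y s] K_even[of "(x + y) / 2" "(r + s) / 2"] by simp
  qed
qed

text \<open>For fixed \<open>s\<close>, the function \<open>s (K(s, x) - s)\<close> is convex in \<open>x\<close>, and it tends to \<open>p(x)/2\<close> as
  \<open>s\<close> goes to infinity.\<close>

lemma convex_on_exponent_of_K:
  fixes p :: "real \<Rightarrow> real"
  assumes "convex_on ({0<..} \<times> S) (\<lambda>(s, x). K p s x)" "convex S"
  shows "convex_on S p"
proof (rule convex_onI)
  fix t x y :: real assume t: "0 < t" "t < 1" and xy: "x \<in> S" "y \<in> S"
  let ?z = "(1 - t) *\<^sub>R x + t *\<^sub>R y"
  note lim = K_asymptotics[of 1, simplified]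
  have "p ?z / 2 \<le> (1 - t) * (p x / 2) + t * (p y / 2)"
  proof (rule tendsto_le[OF _ tendsto_add[OF tendsto_mult_left tendsto_mult_left]])
    show "((\<lambda>s. s * (K p s ?z - s)) \<longlongrightarrow> p ?z / 2) at_top"
      "((\<lambda>s. s * (K p s x - s)) \<longlongrightarrow> p x / 2) at_top"
      "((\<lambda>s. s * (K p s y - s)) \<longlongrightarrow> p y / 2) at_top"
      by (rule lim)+
    show "\<forall>\<^sub>F s in at_top. s * (K p s ?z - s)
        \<le> (1 - t) * (s * (K p s x - s)) + t * (s * (K p s y - s))"
      using eventually_gt_at_top[of 0]
    proof eventually_elim
      case (elim s)
      have "(1 - t) * s + t * s = s" by (simp add: algebra_simps)
      then have "K p s ?z \<le> (1 - t) * K p s x + t * K p s y"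
        using convex_onD[OF assms(1), of t "(s, x)" "(s, y)"] t xy elim by simp
      then have "s * (K p s ?z - s) \<le> s * ((1 - t) * K p s x + t * K p s y - s)"
        using elim by (intro mult_left_mono) auto
      also have "\<dots> = (1 - t) * (s * (K p s x - s)) + t * (s * (K p s y - s))"
        by (simp add: algebra_simps)
      finally show ?case .
    qed
  qed simp
  then show "p ?z \<le> (1 - t) * p x + t * p y" by simp
qed fact

theorem theorem2:
  fixes p :: "real \<Rightarrow> real"
  assumes "continuous_on {-1..1} p"
    and "\<And>x. x \<in> {-1..1} \<Longrightarrow> p x \<ge> 1"
    and "\<And>u. piecewise_linear_on (-1) 1 u \<Longrightarrow> u \<in> W11_zero \<Longrightarrow> (\<forall>x\<in>{-1..1}. u x \<ge> 0)
           \<Longrightarrow> energy p (symmetrization u) \<le> energy p u"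
  shows "(\<forall>x\<in>{-1..1}. p (- x) = p x) \<and> convex_on {-1..1} p
         \<and> convex_on ({0<..} \<times> {-1..1}) (\<lambda>(s, x). K p s x)"
proof -
  have ineq: "K p ((r + s) / 2) (- (B - A) / 2) + K p ((r + s) / 2) ((B - A) / 2) \<le> K p r A + K p s B"
    if "-1 \<le> A" "A < B" "B \<le> 1" "r > 0" "s > 0" for r s A B
    using assms(1,3) that by (rule K_inequality_of_symmetrization)
  have even_pos: "p (- y) = p y" if "0 < y" "y \<le> 1" for y
  proof (rule even_of_K_inequality)
    fix r s :: real assume "r > 0" "s > 0"
    then show "K p ((r + s) / 2) (- y) + K p ((r + s) / 2) y \<le> K p r (- y) + K p s y"
      using ineq[of "- y" y r s] that by simp
  qed
  have even: "p (- x) = p x" if "x \<in> {-1..1}" for x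
    using even_pos[of x] even_pos[of "- x"] that by (cases x "0 :: real" rule: linorder_cases) auto
  have K: "convex_on ({0<..} \<times> {-1..1}) (\<lambda>(s, x). K p s x)"
  proof (rule convex_on_if_midpoint_convex)
    show "convex ({0<..} \<times> {-1..1} :: (real \<times> real) set)"
      by (intro convex_Times convex_real_interval)
    show "continuous_on ({0<..} \<times> {-1..1}) (\<lambda>(s, x). K p s x)"
      using assms(1) by (rule continuous_on_K)
    show "(case (1 / 2) *\<^sub>R (v + w) of (s, x) \<Rightarrow> K p s x)
        \<le> ((case v of (s, x) \<Rightarrow> K p s x) + (case w of (s, x) \<Rightarrow> K p s x)) / 2"
      if "v \<in> {0<..} \<times> {-1..1}" "w \<in> {0<..} \<times> {-1..1}" for v w
    proof -
      have "K p ((fst v + fst w) / 2) ((snd v + snd w) / 2)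
          \<le> (K p (fst v) (snd v) + K p (fst w) (snd w)) / 2"
      proof (rule midpoint_convex_K[OF assms(1) even])
        show "K p ((r + s) / 2) (- (B - A) / 2) + K p ((r + s) / 2) ((B - A) / 2) \<le> K p r A + K p s B"
          if "r > 0" "s > 0" "-1 \<le> A" "A < B" "B \<le> 1" for r s A B
          using that(3-5,1,2) by (rule ineq)
      qed (use that in auto)
      then show ?thesis by (simp add: case_prod_beta)
    qed
  qed
  moreover have "convex_on {-1..1} p"
    using K by (rule convex_on_exponent_of_K) simp
  ultimately show ?thesis using even by blast
qed

end
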